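(* The omitted blocks have unbounded absolute length: $G(n)\to\infty$ as $n\to\infty$. At the same time, $\dfrac{G(n)}{H(n)}\to0$ as $n\to\infty$. Consequently, $\dfrac{H(n+1)}{H(n)}\to1$ as $n\to\infty$.
   Context: $p(n)$ denotes the number of (unrestricted) partitions of the positive integer $n$, $H(n):=p(n)-n$, and for $n\ge3$ the gap length is $G(n):=H(n+1)-H(n)-1$, i.e. the number of integers strictly between the consecutive attained values $H(n)$ and $H(n+1)$ (the length of the omitted block between them). *)

theory Defs
  imports Complex_Main "HOL-Library.Multiset"
begin

text \<open>
  A partition of \<open>n\<close> is a multiset of positive integers with sum \<open>n\<close>.
  There are only finitely many of them, so \<open>card\<close> is the true count.
\<close>
definition partition_number :: "nat \<Rightarrow> nat" where
  "partition_number n = card {M :: nat multiset. (\<forall>k \<in># M. 0 < k) \<and> \<Sum>\<^sub># M = n}"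

text \<open>Integer-valued, so that the subtractions here and in \<open>gap_G\<close> are not truncated.\<close>
definition part_H :: "nat \<Rightarrow> int" where
  "part_H n = int (partition_number n) - int n"

text \<open>
  Meant for \<open>n \<ge> 3\<close>, where \<open>part_H\<close> is strictly increasing and \<open>gap_G n\<close> is the number
  of integers strictly between \<open>part_H n\<close> and \<open>part_H (n + 1)\<close>.
\<close>
definition gap_G :: "nat \<Rightarrow> int" where
  "gap_G n = part_H (n + 1) - part_H n - 1"

end

theory Submission
  imports Defs "HOL-Library.FuncSet"
begin

text \<open>
  Adding a part \<open>1\<close> shows that \<open>p(n+1) - p(n) = q(n+1)\<close>, where \<open>q(n)\<close> counts the partitions
  of \<open>n\<close> without the part \<open>1\<close>; the two-part partitions already make \<open>q\<close> unbounded.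
  To see \<open>q(n) = o(p(n))\<close> we follow Bateman and Erdos.
  Replacing one part \<open>m\<close> of a partition without ones by \<open>m\<close> ones loses no information once \<open>m\<close> is
  recorded as the number of ones, so the total number of distinct part sizes, over all partitions
  counted by \<open>q(n)\<close>, is at most \<open>p(n)\<close>. Hence at most \<open>p(n)/K\<close> of them have \<open>K\<close> or more
  distinct part sizes. The remaining ones are polynomially many in \<open>n\<close>, while \<open>p\<close> grows
  faster than every polynomial.
\<close>

section \<open>Partitions as multisets: covering bound and finiteness\<close>

definition partitions :: "nat \<Rightarrow> nat multiset set" where
  "partitions n = {M. (\<forall>k\<in>#M. 0 < k) \<and> \<Sum>\<^sub># M = n}"

definition partitions_no_1 :: "nat \<Rightarrow> nat multiset set" where
  "partitions_no_1 n = {M \<in> partitions n. 1 \<notin># M}"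

lemma partition_number_eq: "partition_number n = card (partitions n)"
  by (simp add: partition_number_def partitions_def)

text \<open>Such a multiset is built from \<open>K\<close> pairs of a multiplicity and an element,
  each with at most \<open>(n + 1) ^ 2\<close> choices. Asking for a covering set \<open>S\<close>
  yields finiteness and the bound in a single induction.\<close>

lemma few_distinct_elements_bound:
  fixes n K :: nat
  shows "\<exists>S. finite S \<and> card S \<le> (n + 1) ^ (2 * K) \<and>
    {M :: nat multiset. card (set_mset M) \<le> K \<and> (\<forall>k\<in>#M. k \<le> n \<and> count M k \<le> n)} \<subseteq> S"
proof (induction K)
  case 0
  show ?case by (rule exI[of _ "{{#}}"]) auto
next
  case (Suc K)
  then obtain S where S: "finite S" "card S \<le> (n + 1) ^ (2 * K)"
    "{M :: nat multiset. card (set_mset M) \<le> K \<and> (\<forall>k\<in>#M. k \<le> n \<and> count M k \<le> n)} \<subseteq> S"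
    by blast
  define f :: "(nat \<times> nat) \<times> nat multiset \<Rightarrow> nat multiset"
    where "f = (\<lambda>((a, b), M). replicate_mset a b + M)"
  define T where "T = f ` (({..n} \<times> {..n}) \<times> S)"
  have "card T \<le> card (({..n} \<times> {..n}) \<times> S)"
    unfolding T_def by (rule card_image_le) (use S in auto)
  also have "\<dots> = (n + 1) ^ 2 * card S"
    by (simp add: card_cartesian_product power2_eq_square)
  also have "\<dots> \<le> (n + 1) ^ 2 * (n + 1) ^ (2 * K)"
    using S by (intro mult_left_mono) auto
  also have "\<dots> = (n + 1) ^ (2 * Suc K)"
    by (simp add: power_add[symmetric])
  finally have "card T \<le> (n + 1) ^ (2 * Suc K)" .
  moreover have "M \<in> T"
    if M: "card (set_mset M) \<le> Suc K" "\<forall>k\<in>#M. k \<le> n \<and> count M k \<le> n" for M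
  proof (cases "M = {#}")
    case True
    \<comment> \<open>The empty multiset has no element to split off; the pair \<open>(0, 0)\<close>
      adds zero copies and leaves it unchanged.\<close>
    have "M = f ((0, 0), M)" by (simp add: f_def)
    moreover have "M \<in> S" using S(3) True by auto
    ultimately show ?thesis unfolding T_def by blast
  next
    case False
    then obtain b where b: "b \<in># M" by blast
    \<comment> \<open>All copies of \<open>b\<close> go at once, so the number of distinct elements
      drops by one.\<close>
    define N where "N = filter_mset (\<lambda>k. k \<noteq> b) M"
    have "set_mset N = set_mset M - {b}" by (auto simp: N_def)
    then have "card (set_mset N) \<le> K" using M(1) b by simp
    moreover have "\<forall>k\<in>#N. k \<le> n \<and> count N k \<le> n" using M(2) by (auto simp: N_def)
    ultimately have "N \<in> S" using S(3) by blast
    moreover have "M = f ((count M b, b), N)"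
      by (auto simp: f_def N_def multiset_eq_iff)
    moreover have "count M b \<le> n" "b \<le> n" using M(2) b by auto
    ultimately show ?thesis unfolding T_def by (intro image_eqI) auto
  qed
  moreover have "finite T" using S by (auto simp: T_def)
  ultimately show ?case by (intro exI[of _ T]) blast
qed

lemma partition_part_bounds:
  assumes "M \<in> partitions n" "k \<in># M"
  shows "k \<le> n" "count M k \<le> n"
proof -
  have pos: "0 < k" and sum: "\<Sum>\<^sub># M = n" using assms by (auto simp: partitions_def)
  have "M = replicate_mset (count M k) k + filter_mset (\<lambda>j. j \<noteq> k) M"
    by (auto simp: multiset_eq_iff)
  then have "\<Sum>\<^sub># M = \<Sum>\<^sub># (replicate_mset (count M k) k + filter_mset (\<lambda>j. j \<noteq> k) M)"
    by (rule arg_cong)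
  also have "\<dots> = count M k * k + \<Sum>\<^sub># (filter_mset (\<lambda>j. j \<noteq> k) M)"
    by simp
  finally have le: "count M k * k \<le> n" using sum by simp
  moreover have "1 \<le> count M k" using assms(2) by (simp add: Suc_leI)
  ultimately have "1 * k \<le> n" "count M k * 1 \<le> n"
    using pos mult_le_mono1[of 1 "count M k" k] mult_le_mono2[of 1 k "count M k"] by linarith+
  then show "k \<le> n" "count M k \<le> n" by simp_all
qed

lemma finite_partitions: "finite (partitions n)"
proof -
  \<comment> \<open>All parts lie in \<open>{..n}\<close>, so \<open>n + 1\<close> distinct parts is
    no restriction.\<close>
  obtain S where S: "finite S"
    "{M :: nat multiset. card (set_mset M) \<le> n + 1 \<and> (\<forall>k\<in>#M. k \<le> n \<and> count M k \<le> n)} \<subseteq> S"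
    using few_distinct_elements_bound[of n "n + 1"] by blast
  have "card (set_mset M) \<le> n + 1" if "M \<in> partitions n" for M
    using card_mono[of "{..n}" "set_mset M"] partition_part_bounds(1)[OF that] by auto
  then have "partitions n \<subseteq> S" using S(2) partition_part_bounds by blast
  then show ?thesis using S(1) finite_subset by blast
qed

lemma finite_partitions_no_1: "finite (partitions_no_1 n)"
  by (simp add: partitions_no_1_def finite_partitions)

section \<open>Partitions without the part 1\<close>

lemma partition_number_Suc:
  "partition_number (Suc n) = partition_number n + card (partitions_no_1 (Suc n))"
proof -
  have "M \<in> add_mset 1 ` partitions n" if "M \<in> partitions (Suc n)" "1 \<in># M" for M
  proof (rule image_eqI)
    show "M = add_mset 1 (M - {#1#})" using that(2) by simp
    have "\<Sum>\<^sub># M = 1 + \<Sum>\<^sub># (M - {#1#})" using that(2) by (rule sum_mset.remove)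
    then show "M - {#1#} \<in> partitions n"
      using that by (auto simp: partitions_def dest: in_diffD)
  qed
  then have "partitions (Suc n) = add_mset 1 ` partitions n \<union> partitions_no_1 (Suc n)"
    by (auto simp: partitions_no_1_def) (auto simp: partitions_def)
  moreover have "add_mset 1 ` partitions n \<inter> partitions_no_1 (Suc n) = {}"
    by (auto simp: partitions_no_1_def)
  moreover have "card (add_mset 1 ` partitions n) = card (partitions n)"
    by (rule card_image) (simp add: inj_on_def)
  ultimately show ?thesis
    by (simp add: partition_number_eq card_Un_disjoint finite_partitions finite_partitions_no_1)
qed

lemma card_partitions_no_1_ge: "n div 2 - 1 \<le> card (partitions_no_1 n)"
proof -
  \<comment> \<open>The upper limit makes \<open>a\<close> the smaller part, so different
    \<open>a\<close> give different pairs; it also keeps \<open>n - a\<close> at least 2.\<close>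
  have "inj_on (\<lambda>a. {#a, n - a#}) {2..n div 2}"
    by (rule inj_onI) (drule arg_cong[of _ _ set_mset], auto simp: doubleton_eq_iff)
  moreover have "(\<lambda>a. {#a, n - a#}) ` {2..n div 2} \<subseteq> partitions_no_1 n"
    by (auto simp: partitions_no_1_def partitions_def)
  ultimately have "card {2..n div 2} \<le> card (partitions_no_1 n)"
    by (metis card_inj_on_le finite_partitions_no_1)
  then show ?thesis by simp
qed

lemma sum_distinct_parts_no_1_le:
  "(\<Sum>M\<in>partitions_no_1 n. card (set_mset M)) \<le> partition_number n"
proof -
  define f where "f = (\<lambda>(M, m). M - {#m#} + replicate_mset m (1::nat))"
  \<comment> \<open>The domain pairs a partition with one of its distinct parts, so its size is the
    sum to be bounded.\<close>
  have "inj_on f (SIGMA M:partitions_no_1 n. set_mset M)"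
  proof (rule inj_onI, clarify)
    fix M m N k
    assume M: "M \<in> partitions_no_1 n" "m \<in># M" and N: "N \<in> partitions_no_1 n" "k \<in># N"
      and eq: "f (M, m) = f (N, k)"
    have no1: "1 \<notin># M - {#m#}" "1 \<notin># N - {#k#}"
      using M N by (auto simp: partitions_no_1_def dest: in_diffD)
    have "count (f (M, m)) 1 = m" "count (f (N, k)) 1 = k"
      using no1 by (auto simp: f_def not_in_iff)
    then have mk: "m = k" using eq by simp
    then have "M - {#m#} = N - {#m#}" using eq by (simp add: f_def)
    then show "M = N \<and> m = k" using M(2) N(2) mk by (metis insert_DiffM)
  qed
  moreover have "f ` (SIGMA M:partitions_no_1 n. set_mset M) \<subseteq> partitions n"
  proof (clarify)
    fix M m assume M: "M \<in> partitions_no_1 n" "m \<in># M"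
    from M(2) obtain N where "M = add_mset m N" by (metis insert_DiffM)
    then show "f (M, m) \<in> partitions n"
      using M(1) by (auto simp: f_def partitions_no_1_def partitions_def split: if_splits)
  qed
  ultimately have "card (SIGMA M:partitions_no_1 n. set_mset M) \<le> card (partitions n)"
    by (rule card_inj_on_le) (rule finite_partitions)
  then show ?thesis by (simp add: partition_number_eq finite_partitions_no_1)
qed

text \<open>Split at \<open>K\<close> distinct parts: a Markov inequality bounds the partitions
  above, the covering set those below. The factor \<open>K\<close> on both sides avoids
  division.\<close>

lemma card_partitions_no_1_le:
  "K * card (partitions_no_1 n) \<le> partition_number n + K * (n + 1) ^ (2 * K)"
proof -
  define A where "A = {M \<in> partitions_no_1 n. K \<le> card (set_mset M)}"
  define B where "B = {M \<in> partitions_no_1 n. card (set_mset M) < K}"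
  have fin: "finite A" "finite B" by (simp_all add: A_def B_def finite_partitions_no_1)
  have split: "partitions_no_1 n = A \<union> B" "A \<inter> B = {}" by (auto simp: A_def B_def)
  have "K * card A = (\<Sum>M\<in>A. K)" by simp
  also have "\<dots> \<le> (\<Sum>M\<in>A. card (set_mset M))" by (rule sum_mono) (simp add: A_def)
  also have "\<dots> \<le> (\<Sum>M\<in>partitions_no_1 n. card (set_mset M))"
    by (rule sum_mono2) (auto simp: A_def finite_partitions_no_1)
  also have "\<dots> \<le> partition_number n" by (rule sum_distinct_parts_no_1_le)
  finally have A: "K * card A \<le> partition_number n" .
  obtain S where S: "finite S" "card S \<le> (n + 1) ^ (2 * K)"
    "{M :: nat multiset. card (set_mset M) \<le> K \<and> (\<forall>k\<in>#M. k \<le> n \<and> count M k \<le> n)} \<subseteq> S"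
    using few_distinct_elements_bound[of n K] by blast
  have "B \<subseteq> S"
    using S(3) partition_part_bounds by (fastforce simp: B_def partitions_no_1_def)
  then have "card B \<le> (n + 1) ^ (2 * K)" using S card_mono le_trans by blast
  then have "K * card B \<le> K * (n + 1) ^ (2 * K)" by simp
  moreover have "card (partitions_no_1 n) = card A + card B"
    using split fin by (simp add: card_Un_disjoint)
  ultimately show ?thesis
    using A by (simp only: distrib_left add_mono)
qed

section \<open>Superpolynomial growth of the partition number\<close>

text \<open>The multiplicities of the parts \<open>2, \<dots>, m + 1\<close> are free in a fixed range; ones fill up the rest.\<close>
lemma partition_number_ge:
  "(n div (m + 1) ^ 2 + 1) ^ m \<le> partition_number n"
proof -
  \<comment> \<open>Up to \<open>t\<close> copies of each of \<open>m\<close> parts, all at most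
    \<open>m + 1\<close>, use at most \<open>m * (m + 1) * t\<close>, which is at most
    \<open>n\<close>.\<close>
  define t where "t = n div (m + 1) ^ 2"
  define F where "F = {2..m + 1} \<rightarrow>\<^sub>E {..t}"
  define w where "w = (\<lambda>f. \<Sum>i\<in>{2..m + 1}. f i * i)"
  define P where "P = (\<lambda>f. (\<Sum>i\<in>{2..m + 1}. replicate_mset (f i) i) + replicate_mset (n - w f) 1)"
  have w_le: "w f \<le> n" if "f \<in> F" for f
  proof -
    have "w f \<le> (\<Sum>i\<in>{2..m + 1}. t * (m + 1))"
      unfolding w_def using that by (intro sum_mono mult_mono) (auto simp: F_def)
    also have "\<dots> = m * (t * (m + 1))" by simp
    also have "\<dots> \<le> (m + 1) * (t * (m + 1))" by (rule mult_right_mono) auto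
    also have "\<dots> = (n div (m + 1) ^ 2) * (m + 1) ^ 2"
      by (simp only: t_def power2_eq_square mult_ac)
    also have "\<dots> \<le> n" by (rule div_times_less_eq_dividend)
    finally show ?thesis .
  qed
  \<comment> \<open>The ones used as filler do not disturb these counts, since \<open>j\<close> is
    at least 2; hence \<open>P f\<close> determines \<open>f\<close>.\<close>
  have count: "count (P f) j = f j" if "j \<in> {2..m + 1}" for f j
  proof -
    have "count (P f) j = (\<Sum>i\<in>{2..m + 1}. if i = j then f j else 0)"
      unfolding P_def using that by (auto simp: count_sum intro!: sum.cong)
    then show ?thesis using that by simp
  qed
  have "inj_on P F"
  proof (rule inj_onI)
    fix f g assume fg: "f \<in> F" "g \<in> F" "P f = P g"
    then have "f j = g j" if "j \<in> {2..m + 1}" for j using count[OF that] by metis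
    then show "f = g" using fg(1,2) unfolding F_def by (blast intro: PiE_ext)
  qed
  moreover have "P ` F \<subseteq> partitions n"
  proof (rule image_subsetI)
    fix f assume f: "f \<in> F"
    have sum: "\<Sum>\<^sub># (\<Sum>i\<in>I. replicate_mset (f i) i) = (\<Sum>i\<in>I. f i * i)" if "finite I" for I
      using that by induction auto
    have "\<Sum>\<^sub># (P f) = n" using w_le[OF f] by (simp add: P_def sum w_def)
    moreover have "\<forall>k\<in>#P f. 0 < k" 
      by (auto simp: P_def set_mset_sum split: if_splits)
    ultimately show "P f \<in> partitions n" by (simp add: partitions_def)
  qed
  ultimately have "card F \<le> card (partitions n)"
    by (rule card_inj_on_le) (rule finite_partitions)
  then show ?thesis by (simp add: F_def card_PiE partition_number_eq t_def)
qed

text \<open>\<open>partition_number_ge\<close> with \<open>m = k + 1\<close> gives growth of one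
  degree more than \<open>k\<close>, so the quotient is O(1/n).\<close>

lemma power_over_partition_number_tendsto_0:
  "(\<lambda>n. (real n + 1) ^ k / partition_number n) \<longlonglongrightarrow> 0"
proof (rule tendsto_sandwich[OF _ _ tendsto_const])
  \<comment> \<open>This is \<open>(m + 1) ^ 2\<close> for \<open>m = k + 1\<close>.\<close>
  define D :: nat where "D = (k + 2) ^ 2"
  have D: "0 < D" by (simp add: D_def)
  have "(real n + 1) ^ k / partition_number n \<le> real D ^ (k + 1) / (real n + 1)" for n
  proof -
    have "n + 1 \<le> D * (n div D + 1)"
      using dividend_less_times_div[OF D, of n] by simp
    then have "(n + 1) ^ (k + 1) \<le> D ^ (k + 1) * (n div D + 1) ^ (k + 1)"
      unfolding power_mult_distrib[symmetric] by (rule power_mono) simp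
    also have "\<dots> \<le> D ^ (k + 1) * partition_number n"
      using partition_number_ge[of n "k + 1"] by (simp add: D_def)
    finally have "real ((n + 1) ^ (k + 1)) \<le> real (D ^ (k + 1) * partition_number n)"
      by (rule of_nat_mono)
    then have le: "(real n + 1) ^ (k + 1) \<le> real D ^ (k + 1) * partition_number n"
      by (simp only: of_nat_power of_nat_mult of_nat_add of_nat_1)
    have "(n div D + 1) ^ (k + 1) \<le> partition_number n"
      using partition_number_ge[of n "k + 1"] by (simp add: D_def)
    moreover have "0 < (n div D + 1) ^ (k + 1)" by simp
    ultimately have "0 < partition_number n" by linarith
    then show ?thesis using le by (simp add: field_simps)
  qed
  then show "\<forall>\<^sub>F n in sequentially.
      (real n + 1) ^ k / partition_number n \<le> real D ^ (k + 1) / (real n + 1)" by simp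
  show "(\<lambda>n. real D ^ (k + 1) / (real n + 1)) \<longlonglongrightarrow> 0"
    using LIMSEQ_Suc[OF lim_const_over_n[of "real D ^ (k + 1)"]] by (simp add: add.commute)
qed simp

section \<open>Limits of the ratios and of the gaps\<close>

lemma partition_number_pos: "0 < partition_number n"
  using partition_number_ge[of n 0] by simp

lemma no_1_ratio_tendsto_0:
  "(\<lambda>n. card (partitions_no_1 n) / partition_number n) \<longlonglongrightarrow> 0"
proof (rule LIMSEQ_I)
  fix e :: real assume e: "0 < e"
  \<comment> \<open>After division by \<open>K * partition_number n\<close> the counting bound has
    the terms \<open>1 / K\<close> and a polynomial over the partition number; this
    \<open>K\<close>, fixed before \<open>n\<close>, puts the first below
    \<open>e / 2\<close>.\<close>
  obtain K :: nat where K: "2 / e < K" using reals_Archimedean2 by blast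
  have K0: "0 < real K" using e K by (smt (verit) divide_pos_pos)
  have "\<forall>\<^sub>F n in sequentially. (real n + 1) ^ (2 * K) / partition_number n < e / 2"
    by (rule order_tendstoD(2)[OF power_over_partition_number_tendsto_0]) (use e in simp)
  then obtain n0 where n0: "\<And>n. n \<ge> n0 \<Longrightarrow> (real n + 1) ^ (2 * K) / partition_number n < e / 2"
    by (auto simp: eventually_sequentially)
  have "card (partitions_no_1 n) / partition_number n < e" if "n \<ge> n0" for n
  proof -
    have "real K * card (partitions_no_1 n) \<le> partition_number n + real K * (real n + 1) ^ (2 * K)"
      using of_nat_mono[OF card_partitions_no_1_le[of K n], where 'a = real]
      by (simp add: add.commute)
    then have "card (partitions_no_1 n) / partition_number n
        \<le> 1 / K + (real n + 1) ^ (2 * K) / partition_number n"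
      using K0 partition_number_pos[of n] by (simp add: field_simps)
    moreover have "1 / K < e / 2" using K K0 e by (simp add: field_simps)
    ultimately show ?thesis using n0[OF that] by linarith
  qed
  then show "\<exists>n0. \<forall>n\<ge>n0. norm (card (partitions_no_1 n) / partition_number n - 0) < e"
    by auto
qed

text \<open>One unit of the 2 comes from the subtracted argument in \<open>part_H\<close>, the other
  from counting strictly between the values.\<close>

lemma gap_G_eq: "gap_G n = int (card (partitions_no_1 (Suc n))) - 2"
  by (simp add: gap_G_def part_H_def partition_number_Suc)

text \<open>This moves the denominator from \<open>Suc n\<close> to \<open>n\<close>: with
  \<open>r\<close> the old ratio, the quotient of consecutive partition numbers is
  \<open>1 - r\<close>, so the new ratio is \<open>r / (1 - r)\<close>.\<close>

lemma no_1_increment_ratio_tendsto_0: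
  "(\<lambda>n. card (partitions_no_1 (Suc n)) / partition_number n) \<longlonglongrightarrow> 0"
proof -
  define r where "r = (\<lambda>n. card (partitions_no_1 (Suc n)) / partition_number (Suc n))"
  have "r \<longlonglongrightarrow> 0" unfolding r_def by (rule LIMSEQ_Suc[OF no_1_ratio_tendsto_0])
  then have "(\<lambda>n. r n / (1 - r n)) \<longlonglongrightarrow> 0 / (1 - 0)" by (intro tendsto_intros) auto
  moreover have "r n / (1 - r n) = card (partitions_no_1 (Suc n)) / partition_number n" for n
  proof -
    have "real (partition_number n) + card (partitions_no_1 (Suc n)) \<noteq> 0"
      using partition_number_pos[of n] by linarith
    then have "1 - r n = partition_number n / partition_number (Suc n)"
      by (simp add: r_def partition_number_Suc divide_simps)
    then show ?thesis using partition_number_pos[of "Suc n"] by (simp add: r_def)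
  qed
  ultimately show ?thesis by simp
qed

theorem corollary4p2:
  shows "filterlim gap_G at_top sequentially
    \<and> (\<lambda>n. real_of_int (gap_G n) / real_of_int (part_H n)) \<longlonglongrightarrow> 0
    \<and> (\<lambda>n. real_of_int (part_H (n + 1)) / real_of_int (part_H n)) \<longlonglongrightarrow> 1"
proof (intro conjI)
  show "filterlim gap_G at_top sequentially"
  proof (rule filterlim_at_top_mono)
    show "filterlim (\<lambda>n. int (n div 2) - 3) at_top sequentially"
      unfolding filterlim_at_top eventually_sequentially
    proof
      fix Z :: int
      show "\<exists>N. \<forall>n\<ge>N. Z \<le> int (n div 2) - 3"
        by (rule exI[of _ "nat (2 * Z + 8)"]) auto
    qed
    have "int (n div 2) - 3 \<le> gap_G n" for n
      using card_partitions_no_1_ge[of "Suc n"] unfolding gap_G_eq by linarith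
    then show "\<forall>\<^sub>F n in sequentially. int (n div 2) - 3 \<le> gap_G n" by simp
  qed
  have inv_p: "(\<lambda>n. 1 / partition_number n) \<longlonglongrightarrow> 0"
    using power_over_partition_number_tendsto_0[of 0] by simp
  have "(\<lambda>n. (real n + 1) / partition_number n - 1 / partition_number n) \<longlonglongrightarrow> 0 - 0"
    using power_over_partition_number_tendsto_0[of 1] inv_p by (intro tendsto_diff) simp_all
  then have n_p: "(\<lambda>n. n / partition_number n) \<longlonglongrightarrow> 0"
    by (simp add: diff_divide_distrib[symmetric])
  let ?q = "\<lambda>n. card (partitions_no_1 (Suc n)) / partition_number n"
  \<comment> \<open>The shift \<open>c\<close> serves both remaining limits: \<open>c = 0\<close> is
    the gap ratio, \<open>c = 1\<close> the relative increment of \<open>part_H\<close>. Numerator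
    and denominator are divided by the partition number.\<close>
  have gap_ratio: "(\<lambda>n. (gap_G n + c) / part_H n) \<longlonglongrightarrow> 0" for c :: real
  proof -
    have "(\<lambda>n. (?q n + (c - 2) * (1 / partition_number n)) / (1 - n / partition_number n))
        \<longlonglongrightarrow> (0 + (c - 2) * 0) / (1 - 0)"
      by (intro tendsto_intros no_1_increment_ratio_tendsto_0 inv_p n_p) simp
    moreover have "(?q n + (c - 2) * (1 / partition_number n)) / (1 - n / partition_number n)
        = (gap_G n + c) / part_H n" for n
    proof -
      have "?q n + (c - 2) * (1 / partition_number n) = (gap_G n + c) / partition_number n"
        by (simp add: gap_G_eq add_divide_distrib diff_divide_distrib)
      moreover have "1 - n / partition_number n = part_H n / partition_number n"
        using partition_number_pos[of n] by (simp add: part_H_def diff_divide_distrib)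
      ultimately show ?thesis using partition_number_pos[of n] by simp
    qed
    ultimately show ?thesis by simp
  qed
  show "(\<lambda>n. real_of_int (gap_G n) / real_of_int (part_H n)) \<longlonglongrightarrow> 0"
    using gap_ratio[of 0] by simp
  have "(\<lambda>n. 1 + (real_of_int (gap_G n) + 1) / part_H n) \<longlonglongrightarrow> 1 + 0"
    using gap_ratio[of 1] by (intro tendsto_intros)
  \<comment> \<open>Only eventually: \<open>part_H\<close> vanishes at 1, 2 and 3, where division by
    zero gives 0 on the right but 1 on the left.\<close>
  moreover have "\<forall>\<^sub>F n in sequentially.
      1 + (real_of_int (gap_G n) + 1) / part_H n = real_of_int (part_H (n + 1)) / part_H n"
  proof -
    have "\<forall>\<^sub>F n in sequentially. n / partition_number n < 1"
      using order_tendstoD(2)[OF n_p] by simp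
    then show ?thesis
    proof eventually_elim
      case (elim n)
      then have "part_H n \<noteq> 0" using partition_number_pos[of n] by (simp add: part_H_def)
      then show ?case by (simp add: gap_G_def field_simps)
    qed
  qed
  ultimately show "(\<lambda>n. real_of_int (part_H (n + 1)) / real_of_int (part_H n)) \<longlonglongrightarrow> 1"
    by (simp add: tendsto_cong)
qed

end
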